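(* Let $J=\mathrm{diag}(1,-1,1)$, let $a\in\mathbb{R}$ and $b_1,b_2,c_1,c_2\in\mathbb{C}$, and let $$A=\begin{bmatrix} a & b_1 & 0\\ c_1 & -a & b_2\\ 0 & c_2 & a\end{bmatrix},\qquad \Delta=a^2+b_1c_1+b_2c_2 .$$ Then $W^J(A)$ is a nondegenerate hyperbolic disc bounded by a hyperbola $\mathcal H$ with foci at $\pm\Delta^{1/2}$ and non-transverse axis of length $$\left(2|\Delta|-2a^2+|b_1|^2+|b_2|^2+|c_1|^2+|c_2|^2\right)^{1/2}$$ if and only if $$a^2-2|\Delta|<\mathrm{Tr}(A^\#A)<a^2+2|\Delta| .$$ In this case, $C^J(A)$ is the union of the hyperbola $\mathcal H$ and the point $a$.
   Context: For a real diagonal matrix $J\in M_n(\mathbb{C})$ with diagonal entries $\pm1$, put $[x,y]_J=y^*Jx$ for $x,y\in\mathbb{C}^n$. For $A\in M_n(\mathbb{C})$ the $J$-adjoint is $A^\#=JA^*J$. The Krein space numerical range of $A$ is $W^J(A)=W^J_+(A)\cup(-W^J_-(A))\subset\mathbb{C}$, where $W^J_\pm(A)=\{[Ax,x]_J: x\in\mathbb{C}^n,\ [x,x]_J=\pm1\}$ and $-W^J_-(A)=\{-z: z\in W^J_-(A)\}$. Put $\Re^J(A)=\frac{A+A^\#}{2}$ and $\Im^J(A)=\frac{A-A^\#}{2i}$. The boundary generating curve of $W^J(A)$ is the algebraic curve given in homogeneous line coordinates $(u:v:w)$ by $\det(u\,\Re^J(A)+v\,\Im^J(A)+w\,I_n)=0$,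 i.e. the curve whose tangent lines are the lines $ux+vy+w=0$ with $(u:v:w)$ satisfying this equation (the dual of the curve defined by this equation). $C^J(A)\subset\mathbb{R}^2\cong\mathbb{C}$ denotes its real part. A factor of the determinant proportional to $\alpha u+\beta v+w$ ($\alpha,\beta\in\mathbb{R}$) contributes the point $\alpha+i\beta$ to $C^J(A)$; an irreducible quadratic factor contributes the corresponding dual conic. A nondegenerate hyperbola has transverse and non-transverse axes of (full) positive lengths $2\tilde a$, $2\tilde b$, with half the focal distance equal to $(\tilde a^2+\tilde b^2)^{1/2}$. A nondegenerate hyperbolic disc bounded by a nondegenerate hyperbola $\mathcal H$ is the union of $\mathcal H$ and the two open convex regions bounded by its two branches (the regions containing the foci); its boundary is $\mathcal H$. *)

theory Defs
  imports "HOL-Analysis.Analysis" "HOL-Computational_Algebra.Computational_Algebra"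
begin

section \<open>Krein space numerical range\<close>

definition conj_transpose :: "complex^'n^'m \<Rightarrow> complex^'m^'n" where
  "conj_transpose A = (\<chi> i j. cnj (A $ j $ i))"

text \<open>The form \<open>[x, y]\<^sub>J = y\<^sup>* J x\<close>. In everything below \<open>J\<close> is meant to be a diagonal matrix with
  diagonal entries \<open>1\<close> or \<open>-1\<close>.\<close>

definition krein_form :: "complex^'n^'n \<Rightarrow> complex^'n \<Rightarrow> complex^'n \<Rightarrow> complex" where
  "krein_form J x y = (\<Sum>i\<in>UNIV. cnj (y $ i) * (J *v x) $ i)"

definition krein_adjoint :: "complex^'n^'n \<Rightarrow> complex^'n^'n \<Rightarrow> complex^'n^'n" where
  "krein_adjoint J A = J ** conj_transpose A ** J"

definition krein_range_pos :: "complex^'n^'n \<Rightarrow> complex^'n^'n \<Rightarrow> complex set" where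
  "krein_range_pos J A = {krein_form J (A *v x) x | x. krein_form J x x = 1}"

definition krein_range_neg :: "complex^'n^'n \<Rightarrow> complex^'n^'n \<Rightarrow> complex set" where
  "krein_range_neg J A = {krein_form J (A *v x) x | x. krein_form J x x = - 1}"

definition krein_range :: "complex^'n^'n \<Rightarrow> complex^'n^'n \<Rightarrow> complex set" where
  "krein_range J A = krein_range_pos J A \<union> uminus ` krein_range_neg J A"

definition krein_Re :: "complex^'n^'n \<Rightarrow> complex^'n^'n \<Rightarrow> complex^'n^'n" where
  "krein_Re J A = (\<chi> i j. (A $ i $ j + krein_adjoint J A $ i $ j) / 2)"

definition krein_Im :: "complex^'n^'n \<Rightarrow> complex^'n^'n \<Rightarrow> complex^'n^'n" where
  "krein_Im J A = (\<chi> i j. (A $ i $ j - krein_adjoint J A $ i $ j) / (2 * \<i>))"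


section \<open>Plane projective curves and their duals\<close>

text \<open>Polynomials in three variables \<open>u\<close>, \<open>v\<close>, \<open>w\<close> are iterated univariate polynomials, that is
  \<open>\<complex>[u][v][w]\<close>: the innermost variable is \<open>u\<close>, the outermost one is \<open>w\<close>.\<close>

type_synonym poly3 = "complex poly poly poly"

definition const3 :: "complex \<Rightarrow> poly3" where "const3 c = [:[:[:c:]:]:]"
definition var_u :: poly3 where "var_u = [:[:[:0, 1:]:]:]"
definition var_v :: poly3 where "var_v = [:[:0, 1:]:]"
definition var_w :: poly3 where "var_w = [:0, 1:]"

definition eval3 :: "poly3 \<Rightarrow> complex^3 \<Rightarrow> complex" where
  "eval3 P p = poly (poly (poly P [:[:p $ 3:]:]) [:p $ 2:]) (p $ 1)"

definition grad3 :: "poly3 \<Rightarrow> complex^3 \<Rightarrow> complex^3" where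
  "grad3 P p = vector [eval3 (map_poly (map_poly pderiv) P) p,
                       eval3 (map_poly pderiv P) p,
                       eval3 (pderiv P) p]"

definition zariski_closure :: "(complex^3) set \<Rightarrow> (complex^3) set" where
  "zariski_closure S = {q. \<forall>G. (\<forall>s\<in>S. eval3 G s = 0) \<longrightarrow> eval3 G q = 0}"

text \<open>Subsets of the projective plane are represented by their cones in \<open>\<complex>\<^sup>3\<close>. The dual of \<open>F = 0\<close>
  is the union, over the irreducible factors \<open>P\<close> of \<open>F\<close>, of the Zariski closures of the sets of
  tangent lines to \<open>P = 0\<close> at its smooth points; the tangent line at \<open>p\<close> has the homogeneous
  coordinates \<open>grad3 P p\<close>. Singular points only contribute the zero vector, which does not represent
  a projective point. For \<open>P = \<alpha> u + \<beta> v + w\<close> one gets the single point \<open>(\<alpha> : \<beta> : 1)\<close>.\<close>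

definition dual_curve_cone :: "poly3 \<Rightarrow> (complex^3) set" where
  "dual_curve_cone F = (\<Union>P\<in>{P. irreducible P \<and> P dvd F}.
     zariski_closure {t *s grad3 P p | t p. p \<noteq> 0 \<and> eval3 P p = 0})"

definition krein_poly :: "complex^'n^'n \<Rightarrow> complex^'n^'n \<Rightarrow> poly3" where
  "krein_poly J A = det (\<chi> i j. var_u * const3 (krein_Re J A $ i $ j)
                              + var_v * const3 (krein_Im J A $ i $ j)
                              + mat var_w $ i $ j)"

text \<open>The real affine points of the boundary generating curve.\<close>

definition krein_curve :: "complex^'n^'n \<Rightarrow> complex^'n^'n \<Rightarrow> complex set" where
  "krein_curve J A =
     {Complex x y | x y. vector [complex_of_real x, complex_of_real y, 1]
                           \<in> dual_curve_cone (krein_poly J A)}"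


section \<open>Hyperbolas\<close>

text \<open>Hyperbola with foci \<open>f\<close>, \<open>g\<close> and transverse axis of length \<open>2 * s\<close>.\<close>

definition hyperbola :: "complex \<Rightarrow> complex \<Rightarrow> real \<Rightarrow> complex set" where
  "hyperbola f g s = {z. \<bar>dist z f - dist z g\<bar> = 2 * s}"

text \<open>The two sets added here are, for \<open>0 < 2 * s < dist f g\<close>, the open convex regions bounded by
  the branches, containing \<open>f\<close> and \<open>g\<close> respectively.\<close>

definition hyperbolic_disc :: "complex \<Rightarrow> complex \<Rightarrow> real \<Rightarrow> complex set" where
  "hyperbolic_disc f g s = hyperbola f g s
     \<union> {z. dist z g - dist z f > 2 * s} \<union> {z. dist z f - dist z g > 2 * s}"

text \<open>\<open>D\<close> is the nondegenerate hyperbolic disc bounded by the hyperbola \<open>H\<close> with foci \<open>f\<close>, \<open>g\<close> and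
  non-transverse axis of length \<open>l\<close>; \<open>s\<close> and \<open>t\<close> are the semi-axes.\<close>

definition nondegenerate_hyperbolic_disc ::
    "complex set \<Rightarrow> complex set \<Rightarrow> complex \<Rightarrow> complex \<Rightarrow> real \<Rightarrow> bool" where
  "nondegenerate_hyperbolic_disc D H f g l \<longleftrightarrow>
     (\<exists>s t. s > 0 \<and> t > 0 \<and> dist f g / 2 = sqrt (s\<^sup>2 + t\<^sup>2) \<and> l = 2 * t \<and>
        H = hyperbola f g s \<and> D = hyperbolic_disc f g s)"

text \<open>\<open>Tr (A\<^sup># A)\<close> is real, so that inequalities for it may be stated through \<open>Re\<close>.\<close>

lemma trace_krein_adjoint_mult_real:
  assumes "conj_transpose J = J"
  shows "trace (krein_adjoint J A ** A) \<in> \<real>"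
proof -
  have ct_mult: "conj_transpose (X ** Y) = conj_transpose Y ** conj_transpose X"
    for X Y :: "complex^'a^'a"
    by (simp add: conj_transpose_def matrix_matrix_mult_def vec_eq_iff mult.commute)
  have ct_ct: "conj_transpose (conj_transpose X) = X" for X :: "complex^'a^'a"
    by (simp add: conj_transpose_def vec_eq_iff)
  have tr: "trace (conj_transpose X) = cnj (trace X)" for X :: "complex^'a^'a"
    by (simp add: conj_transpose_def trace_def)
  have "cnj (trace (krein_adjoint J A ** A)) = trace (conj_transpose (krein_adjoint J A ** A))"
    by (simp add: tr)
  also have "\<dots> = trace ((conj_transpose A ** J ** A) ** J)"
    by (simp add: krein_adjoint_def ct_mult ct_ct assms matrix_mul_assoc)
  also have "\<dots> = trace (J ** (conj_transpose A ** J ** A))"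
    by (rule trace_mul_sym)
  also have "\<dots> = trace (krein_adjoint J A ** A)"
    by (simp add: krein_adjoint_def matrix_mul_assoc)
  finally show ?thesis
    by (simp add: Reals_cnj_iff)
qed

end

theory Submission imports Defs begin

text \<open>The value \<open>[A x, x]\<close> is a real-linear function of \<open>X = \<bar>x\<bar>\<^sup>2\<close> and
  \<open>y = 2 cnj x\<^sub>2 (x\<^sub>1, x\<^sub>3)\<close>, and \<open>X\<^sup>2 - \<bar>y\<bar>\<^sup>2 = [x, x]\<^sup>2\<close>. Hence \<open>W\<^sup>J(A)\<close> is the image of the
  hyperboloid \<open>X\<^sup>2 - \<bar>y\<bar>\<^sup>2 = 1\<close> of \<open>\<real> \<times> \<complex>\<^sup>2\<close> under a real-linear map to the plane. The Lorentz
  form pushed forward along the map is the dual of the quadratic form \<open>p u\<^sup>2 + r u v - t v\<^sup>2\<close> with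
  \<open>p = (2 Re \<Delta> - N)/4\<close>, \<open>r = Im \<Delta>\<close>, \<open>t = (2 Re \<Delta> + N)/4\<close>, where
  \<open>N = \<bar>b\<^sub>1\<bar>\<^sup>2 + \<bar>b\<^sub>2\<bar>\<^sup>2 + \<bar>c\<^sub>1\<bar>\<^sup>2 + \<bar>c\<^sub>2\<bar>\<^sup>2 - 2 a\<^sup>2\<close>. If \<open>\<bar>N\<bar> < 2 \<bar>\<Delta>\<bar>\<close>, which is the trace condition,
  this form is indefinite, and the image is the set where
  \<open>N \<bar>z\<bar>\<^sup>2 + 2 Re (cnj \<Delta> z\<^sup>2) \<ge> (4 \<bar>\<Delta>\<bar>\<^sup>2 - N\<^sup>2)/4\<close>; since \<open>\<bar>z - f\<bar> \<bar>z + f\<bar> = \<bar>z\<^sup>2 - \<Delta>\<bar>\<close> for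
  \<open>f\<^sup>2 = \<Delta>\<close>, this is the hyperbolic disc with foci \<open>f\<close> and \<open>-f\<close>. Conversely, the focal distance and
  the prescribed axis force \<open>\<bar>N\<bar> < 2 \<bar>\<Delta>\<bar>\<close> because both semi-axes are positive. The determinant
  factors as \<open>(a u + w) (w\<^sup>2 - p u\<^sup>2 - r u v + t v\<^sup>2)\<close>, and the dual of the second factor is the same
  hyperbola.\<close>

no_notation fps_nth (infixl "$" 75)

section \<open>Images of a two-sheeted hyperboloid in the plane\<close>

text \<open>For c < 0 the vector (-c, b) is orthogonal to (0, 1) with respect to the form, and a
  negative determinant forces opposite signs on the two.\<close>

lemma indefinite_binary_form_pos:
  fixes p b c :: real
  assumes "p * c < b\<^sup>2"
  obtains \<theta> \<eta> where "0 < p * \<theta>\<^sup>2 + 2 * b * \<theta> * \<eta> + c * \<eta>\<^sup>2"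
proof -
  consider "c > 0" | "c = 0" | "c < 0" by linarith
  then show thesis
  proof cases
    case 1
    then show thesis using that[of 0 1] by simp
  next
    case 2
    then have "b \<noteq> 0" using assms by auto
    \<comment> \<open>With c = 0 and \<theta> = 1 the form is affine in \<eta> with slope 2 b, so it
      can be made equal to 1.\<close>
    then have "p * 1\<^sup>2 + 2 * b * 1 * ((1 - p) / (2 * b)) + c * ((1 - p) / (2 * b))\<^sup>2 = 1"
      using 2 by simp
    then show thesis using that[of 1 "(1 - p) / (2 * b)"] by simp
  next
    case 3
    have "p * (- c)\<^sup>2 + 2 * b * (- c) * b + c * b\<^sup>2 = c * (p * c - b\<^sup>2)"
      by (simp add: power2_eq_square algebra_simps)
    also have "\<dots> > 0"
      using 3 assms by (simp add: mult_neg_neg)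
    finally show thesis using that[of "- c" b] by blast
  qed
qed

text \<open>Cauchy-Schwarz: next to a vector (e0, e) of positive Lorentz square there is no room for
  an orthogonal one of positive square.\<close>

lemma lorentz_orthogonal_nonpos:
  fixes e y :: "'a::real_inner" and e0 X :: real
  assumes "e \<bullet> e < e0\<^sup>2" "X * e0 = y \<bullet> e"
  shows "X\<^sup>2 \<le> y \<bullet> y"
proof -
  have pos: "0 < e0\<^sup>2"
    using assms(1) inner_ge_zero[of e] by linarith
  have "X\<^sup>2 * e0\<^sup>2 = (y \<bullet> e)\<^sup>2"
    using assms(2) by (metis power_mult_distrib)
  also have "\<dots> \<le> (y \<bullet> y) * (e \<bullet> e)"
    by (rule Cauchy_Schwarz_ineq)
  also have "\<dots> \<le> (y \<bullet> y) * e0\<^sup>2"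
    using assms(1) by (intro mult_left_mono) auto
  finally show ?thesis
    using pos by simp
qed

text \<open>The functionals are represented through the Lorentz form by \<open>(\<alpha>, -u)\<close> and \<open>(\<beta>, -v)\<close>, whose
  Gram matrix has entries \<open>p\<close>, \<open>b\<close>, \<open>c\<close>. Since it is indefinite, the common kernel is negative
  definite, so the Lorentz form on a fibre is bounded above only by its value at the point of the
  fibre that lies in the span of the two vectors.\<close>

lemma hyperboloid_image_iff:
  fixes u v :: "'a::euclidean_space" and \<alpha> \<beta> x w :: real
  assumes dim: "DIM('a) > 2"
    and p: "p = \<alpha>\<^sup>2 - u \<bullet> u" and b: "b = \<alpha> * \<beta> - u \<bullet> v" and c: "c = \<beta>\<^sup>2 - v \<bullet> v"
    and indef: "p * c < b\<^sup>2"
  shows "(\<exists>X y. X\<^sup>2 - y \<bullet> y = 1 \<and> \<alpha> * X + u \<bullet> y = x \<and> \<beta> * X + v \<bullet> y = w) \<longleftrightarrow>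
         c * x\<^sup>2 - 2 * b * x * w + p * w\<^sup>2 \<le> p * c - b\<^sup>2" (is "?L \<longleftrightarrow> ?R")
proof -
  define D where "D = p * c - b\<^sup>2"
  have D: "D < 0" using indef by (simp add: D_def)
  define \<kappa> where "\<kappa> = c * x\<^sup>2 - 2 * b * x * w + p * w\<^sup>2"
  \<comment> \<open>Cramer's rule for the Gram system: at the point m (\<alpha>, -u) + n (\<beta>,
    -v) of the span the functionals take the values x and w. The Lorentz square of this point is
    \<open>\<kappa> / D\<close>.\<close>
  define m where "m = (c * x - b * w) / D"
  define n where "n = (p * w - b * x) / D"
  have mD: "m * D = c * x - b * w" and nD: "n * D = p * w - b * x"
    using D by (simp_all add: m_def n_def)
  have x: "m * p + n * b = x"
  proof -
    have "(m * p + n * b) * D = x * D"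
      using mD nD unfolding D_def by algebra
    then show ?thesis using D by simp
  qed
  have w: "m * b + n * c = w"
  proof -
    have "(m * b + n * c) * D = w * D"
      using mD nD unfolding D_def by algebra
    then show ?thesis using D by simp
  qed
  have \<kappa>: "m * x + n * w = \<kappa> / D"
  proof -
    have "(m * x + n * w) * D = \<kappa>"
      using mD nD unfolding \<kappa>_def by algebra
    then show ?thesis using D by (simp add: field_simps)
  qed
  have R: "?R \<longleftrightarrow> 1 \<le> \<kappa> / D"
    using D by (simp add: le_divide_eq flip: D_def \<kappa>_def)
  show ?thesis
  proof
    assume ?L
    then obtain X y where Q: "X\<^sup>2 - y \<bullet> y = 1" and Lx: "\<alpha> * X + u \<bullet> y = x" and Lw: "\<beta> * X + v \<bullet> y = w"
      by blast
    \<comment> \<open>This yields a vector of positive square in the span. The component (X', y') of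
      (X, y) orthogonal to the span is orthogonal to it, hence has nonpositive square.\<close>
    obtain \<theta> \<eta> where pos: "0 < p * \<theta>\<^sup>2 + 2 * b * \<theta> * \<eta> + c * \<eta>\<^sup>2"
      using indefinite_binary_form_pos[OF indef] .
    define X' where "X' = X - m * \<alpha> - n * \<beta>"
    define y' where "y' = y + m *\<^sub>R u + n *\<^sub>R v"
    have o1: "\<alpha> * X' + u \<bullet> y' = 0"
      using x Lx unfolding X'_def y'_def p b
      by (simp add: inner_add_right algebra_simps power2_eq_square)
    have o2: "\<beta> * X' + v \<bullet> y' = 0"
      using w Lw unfolding X'_def y'_def b c
      by (simp add: inner_add_right algebra_simps power2_eq_square inner_commute)
    have "X'\<^sup>2 \<le> (- y') \<bullet> (- y')"
    proof (rule lorentz_orthogonal_nonpos)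
      show "(\<theta> *\<^sub>R u + \<eta> *\<^sub>R v) \<bullet> (\<theta> *\<^sub>R u + \<eta> *\<^sub>R v) < (\<theta> * \<alpha> + \<eta> * \<beta>)\<^sup>2"
        using pos unfolding p b c
        by (simp add: inner_add_right inner_add_left algebra_simps power2_eq_square inner_commute)
      have "X' * (\<theta> * \<alpha> + \<eta> * \<beta>) + (\<theta> *\<^sub>R u + \<eta> *\<^sub>R v) \<bullet> y'
          = \<theta> * (\<alpha> * X' + u \<bullet> y') + \<eta> * (\<beta> * X' + v \<bullet> y')"
        by (simp add: inner_add_left algebra_simps)
      then show "X' * (\<theta> * \<alpha> + \<eta> * \<beta>) = (- y') \<bullet> (\<theta> *\<^sub>R u + \<eta> *\<^sub>R v)"
        unfolding o1 o2 by (simp add: inner_commute)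
    qed
    then have "X'\<^sup>2 \<le> y' \<bullet> y'" by simp
    \<comment> \<open>Pythagoras for the Lorentz form: the squares of the two components of (X, y)
      add up to 1.\<close>
    moreover have "X'\<^sup>2 - y' \<bullet> y' = 1 - \<kappa> / D"
    proof -
      have "X'\<^sup>2 - y' \<bullet> y' = X' * X - y' \<bullet> y - m * (\<alpha> * X' + u \<bullet> y') - n * (\<beta> * X' + v \<bullet> y')"
        by (simp add: X'_def y'_def inner_add_left inner_add_right algebra_simps power2_eq_square inner_commute)
      also have "\<dots> = X\<^sup>2 - y \<bullet> y - (m * (\<alpha> * X + u \<bullet> y) + n * (\<beta> * X + v \<bullet> y))"
        unfolding o1 o2 by (simp add: X'_def y'_def inner_add_left algebra_simps power2_eq_square)
      finally show ?thesis
        by (simp add: Q Lx Lw \<kappa>)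
    qed
    ultimately show ?R using R by simp
  next
    assume ?R
    \<comment> \<open>A unit vector k orthogonal to u and v exists in dimension above 2. Moving by
      \<tau> k stays in the fibre and lowers the Lorentz square by exactly the excess over
      1.\<close>
    have "dim {u, v} < DIM('a)"
      using dim dim_le_card'[of "{u, v}"] card_insert_le_m1[of 2 "{v}" u] by simp
    then obtain k0 :: 'a where k0: "k0 \<noteq> 0" "\<And>y. y \<in> span {u, v} \<Longrightarrow> orthogonal k0 y"
      using orthogonal_to_subspace_exists[of "{u, v}"] by auto
    define k where "k = sgn k0"
    have k: "u \<bullet> k = 0" "v \<bullet> k = 0" "k \<bullet> u = 0" "k \<bullet> v = 0" "k \<bullet> k = 1"
      using k0(1) k0(2)[of u] k0(2)[of v]
      by (simp_all add: k_def sgn_div_norm orthogonal_def inner_commute span_base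
          dot_square_norm power2_eq_square)
    define \<tau> where "\<tau> = sqrt (\<kappa> / D - 1)"
    have \<tau>: "\<tau>\<^sup>2 = \<kappa> / D - 1"
      using \<open>?R\<close> R by (simp add: \<tau>_def)
    define X where "X = m * \<alpha> + n * \<beta>"
    define y where "y = \<tau> *\<^sub>R k - m *\<^sub>R u - n *\<^sub>R v"
    have Lx: "\<alpha> * X + u \<bullet> y = x"
      unfolding x[symmetric] X_def y_def p b
      by (simp add: inner_diff_right k algebra_simps power2_eq_square)
    have Lw: "\<beta> * X + v \<bullet> y = w"
      unfolding w[symmetric] X_def y_def b c
      by (simp add: inner_diff_right k algebra_simps power2_eq_square inner_commute)
    have "X\<^sup>2 - y \<bullet> y = m * (\<alpha> * X + u \<bullet> y) + n * (\<beta> * X + v \<bullet> y) - \<tau> * (k \<bullet> y)"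
      by (simp add: X_def y_def inner_diff_left inner_diff_right k algebra_simps power2_eq_square inner_commute)
    also have "k \<bullet> y = \<tau>"
      using k by (simp add: y_def inner_diff_right inner_commute)
    finally have "X\<^sup>2 - y \<bullet> y = 1"
      using \<kappa> \<tau> by (simp add: Lx Lw power2_eq_square)
    with Lx Lw show ?L by blast
  qed
qed

section \<open>Hyperbolas with foci symmetric about the origin\<close>

text \<open>The parallelogram law for z and f.\<close>

lemma sum_squares_dist_antipodal:
  fixes z f :: complex
  shows "(dist z f)\<^sup>2 + (dist z (- f))\<^sup>2 = 2 * ((cmod z)\<^sup>2 + cmod (f\<^sup>2))"
proof -
  have "(dist z f)\<^sup>2 + (dist z (- f))\<^sup>2 = 2 * ((cmod z)\<^sup>2 + (cmod f)\<^sup>2)"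
    unfolding dist_norm cmod_power2 by (simp add: power2_eq_square algebra_simps)
  then show ?thesis by (simp add: norm_power)
qed

lemma mult_dist_antipodal:
  fixes z f :: complex
  shows "(dist z f * dist z (- f))\<^sup>2 = ((cmod z)\<^sup>2)\<^sup>2 - 2 * Re (cnj (f\<^sup>2) * z\<^sup>2) + (cmod (f\<^sup>2))\<^sup>2"
proof -
  have "dist z f * dist z (- f) = cmod (z\<^sup>2 - f\<^sup>2)"
    by (simp add: dist_norm flip: norm_mult) (simp add: power2_eq_square algebra_simps)
  also have "\<dots>\<^sup>2 = (cmod (z\<^sup>2))\<^sup>2 - 2 * Re (cnj (f\<^sup>2) * z\<^sup>2) + (cmod (f\<^sup>2))\<^sup>2"
    unfolding cmod_power2 by (simp add: power2_eq_square algebra_simps)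
  finally show ?thesis by (simp add: norm_power)
qed

text \<open>The focal relation is phrased through the square of f because only this square, later
  \<Delta>, enters the equation of the curve.\<close>

locale centered_hyperbola =
  fixes f :: complex and s t :: real
  assumes s: "s > 0" and t: "t > 0" and focal: "s\<^sup>2 + t\<^sup>2 = cmod (f\<^sup>2)"
begin

text \<open>First of two squarings that clear the roots from the bifocal equation; what remains is
  the product of the focal distances.\<close>

lemma dist_diff_square:
  "(dist z f - dist z (- f))\<^sup>2 - (2 * s)\<^sup>2
     = 2 * ((cmod z)\<^sup>2 + t\<^sup>2 - s\<^sup>2 - dist z f * dist z (- f))"
  using sum_squares_dist_antipodal[of z f] focal
  by (simp add: power2_diff power_mult_distrib algebra_simps)

lemma dist_mult_square:
  "((cmod z)\<^sup>2 + t\<^sup>2 - s\<^sup>2)\<^sup>2 - (dist z f * dist z (- f))\<^sup>2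
     = 2 * ((t\<^sup>2 - s\<^sup>2) * (cmod z)\<^sup>2 + Re (cnj (f\<^sup>2) * z\<^sup>2) - 2 * s\<^sup>2 * t\<^sup>2)"
  unfolding mult_dist_antipodal focal[symmetric]
  by (simp add: power2_eq_square algebra_simps)

text \<open>Guarantees that \<open>(cmod z)\<^sup>2 + t\<^sup>2 - s\<^sup>2\<close> is nonnegative,
  which makes the second squaring reversible. The real part is bounded by the modulus, and the terms
  in s cancel.\<close>

lemma level_imp_norm_ge:
  assumes "2 * s\<^sup>2 * t\<^sup>2 \<le> (t\<^sup>2 - s\<^sup>2) * (cmod z)\<^sup>2 + Re (cnj (f\<^sup>2) * z\<^sup>2)"
  shows "s\<^sup>2 \<le> (cmod z)\<^sup>2"
proof -
  have "Re (cnj (f\<^sup>2) * z\<^sup>2) \<le> cmod (cnj (f\<^sup>2) * z\<^sup>2)"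
    by (rule complex_Re_le_cmod)
  also have "\<dots> = (s\<^sup>2 + t\<^sup>2) * (cmod z)\<^sup>2"
    by (simp add: norm_mult norm_power focal)
  finally have "2 * s\<^sup>2 * t\<^sup>2 \<le> 2 * t\<^sup>2 * (cmod z)\<^sup>2"
    using assms by (simp add: algebra_simps)
  then show ?thesis using t by simp
qed

lemma mem_hyperbola_iff:
  "z \<in> hyperbola f (- f) s \<longleftrightarrow>
     (t\<^sup>2 - s\<^sup>2) * (cmod z)\<^sup>2 + Re (cnj (f\<^sup>2) * z\<^sup>2) = 2 * s\<^sup>2 * t\<^sup>2" (is "_ \<longleftrightarrow> ?K = _")
proof -
  let ?r = "(cmod z)\<^sup>2 + t\<^sup>2 - s\<^sup>2" and ?d = "dist z f * dist z (- f)"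
  have "z \<in> hyperbola f (- f) s \<longleftrightarrow> (dist z f - dist z (- f))\<^sup>2 = (2 * s)\<^sup>2"
    unfolding power2_eq_iff hyperbola_def using s by auto
  also have "\<dots> \<longleftrightarrow> ?r = ?d"
    using dist_diff_square[of z] by auto
  also have "\<dots> \<longleftrightarrow> ?K = 2 * s\<^sup>2 * t\<^sup>2"
  proof
    assume "?r = ?d"
    then show "?K = 2 * s\<^sup>2 * t\<^sup>2" using dist_mult_square[of z] by simp
  next
    assume K: "?K = 2 * s\<^sup>2 * t\<^sup>2"
    then have "?r\<^sup>2 = ?d\<^sup>2" using dist_mult_square[of z] by simp
    moreover have "0 \<le> ?r"
      using level_imp_norm_ge[of z] K zero_le_power2[of t] by linarith
    ultimately show "?r = ?d" by (simp add: power2_eq_iff_nonneg)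
  qed
  finally show ?thesis .
qed

lemma mem_hyperbolic_disc_iff:
  "z \<in> hyperbolic_disc f (- f) s \<longleftrightarrow>
     2 * s\<^sup>2 * t\<^sup>2 \<le> (t\<^sup>2 - s\<^sup>2) * (cmod z)\<^sup>2 + Re (cnj (f\<^sup>2) * z\<^sup>2)" (is "_ \<longleftrightarrow> _ \<le> ?K")
proof -
  let ?r = "(cmod z)\<^sup>2 + t\<^sup>2 - s\<^sup>2" and ?d = "dist z f * dist z (- f)"
  have "z \<in> hyperbolic_disc f (- f) s \<longleftrightarrow> \<bar>2 * s\<bar> \<le> \<bar>dist z f - dist z (- f)\<bar>"
    using s by (auto simp: hyperbolic_disc_def hyperbola_def)
  also have "\<dots> \<longleftrightarrow> (2 * s)\<^sup>2 \<le> (dist z f - dist z (- f))\<^sup>2"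
    by (rule abs_le_square_iff)
  also have "\<dots> \<longleftrightarrow> ?d \<le> ?r"
    using dist_diff_square[of z] by auto
  also have "\<dots> \<longleftrightarrow> 2 * s\<^sup>2 * t\<^sup>2 \<le> ?K"
  proof
    assume "?d \<le> ?r"
    then have "?d\<^sup>2 \<le> ?r\<^sup>2" by (rule power_mono) simp
    then show "2 * s\<^sup>2 * t\<^sup>2 \<le> ?K" using dist_mult_square[of z] by simp
  next
    assume K: "2 * s\<^sup>2 * t\<^sup>2 \<le> ?K"
    then have "?d\<^sup>2 \<le> ?r\<^sup>2" using dist_mult_square[of z] by simp
    moreover have "0 \<le> ?r"
      using level_imp_norm_ge[OF K] zero_le_power2[of t] by linarith
    ultimately show "?d \<le> ?r" by (rule power2_le_imp_le)
  qed
  finally show ?thesis .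
qed

end

section \<open>The Krein space numerical range of a tridiagonal matrix\<close>

abbreviation (input) J3 :: "complex^3^3" where
  "J3 \<equiv> vector [vector [1, 0, 0], vector [0, -1, 0], vector [0, 0, 1]]"

abbreviation (input) tridiag3 :: "real \<Rightarrow> complex \<Rightarrow> complex \<Rightarrow> complex \<Rightarrow> complex \<Rightarrow> complex^3^3" where
  "tridiag3 a b\<^sub>1 b\<^sub>2 c\<^sub>1 c\<^sub>2 \<equiv> vector [vector [of_real a, b\<^sub>1, 0],
     vector [c\<^sub>1, - of_real a, b\<^sub>2], vector [0, c\<^sub>2, of_real a]]"

lemma krein_form_J3:
  "krein_form J3 x x = of_real ((cmod (x $ 1))\<^sup>2 - (cmod (x $ 2))\<^sup>2 + (cmod (x $ 3))\<^sup>2)"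
  by (simp add: krein_form_def matrix_vector_mult_def sum_3 complex_norm_square mult.commute
      del: of_real_power)

text \<open>To be read with \<open>X = \<bar>x\<bar>\<^sup>2\<close> and
  \<open>y = 2 * cnj x\<^sub>2 * (x\<^sub>1, x\<^sub>3)\<close>; these satisfy \<open>X\<^sup>2 - \<bar>y\<bar>\<^sup>2 = [x, x]\<^sup>2\<close>.\<close>

definition krein_value :: "real \<Rightarrow> complex \<Rightarrow> complex \<Rightarrow> complex \<Rightarrow> complex \<Rightarrow> real \<Rightarrow> complex \<times> complex \<Rightarrow> complex"
  where "krein_value a b\<^sub>1 b\<^sub>2 c\<^sub>1 c\<^sub>2 X y =
    of_real (a * X) + (b\<^sub>1 * cnj (fst y) - c\<^sub>1 * fst y + c\<^sub>2 * cnj (snd y) - b\<^sub>2 * snd y) / 2"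

lemma krein_form_tridiag3:
  "krein_form J3 (tridiag3 a b\<^sub>1 b\<^sub>2 c\<^sub>1 c\<^sub>2 *v x) x =
   krein_value a b\<^sub>1 b\<^sub>2 c\<^sub>1 c\<^sub>2 ((cmod (x $ 1))\<^sup>2 + (cmod (x $ 2))\<^sup>2 + (cmod (x $ 3))\<^sup>2)
     (2 * cnj (x $ 2) * x $ 1, 2 * cnj (x $ 2) * x $ 3)"
  by (simp add: krein_form_def krein_value_def matrix_vector_mult_def sum_3 complex_norm_square
      field_simps del: of_real_power)

lemma krein_value_minus:
  "krein_value a b\<^sub>1 b\<^sub>2 c\<^sub>1 c\<^sub>2 (- X) (- y) = - krein_value a b\<^sub>1 b\<^sub>2 c\<^sub>1 c\<^sub>2 X y"
  by (simp add: krein_value_def field_simps)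

text \<open>The sheet X > 0 accounts for the positive part of the range, the sheet X < 0 for the
  negated negative part. Surjectivity comes from |x|^2 and [x, x], which determine the modulus of
  \<open>x $ 2\<close>; taking this entry real and positive lets the others be recovered by
  division.\<close>

lemma krein_range_tridiag3:
  "z \<in> krein_range J3 (tridiag3 a b\<^sub>1 b\<^sub>2 c\<^sub>1 c\<^sub>2) \<longleftrightarrow>
   (\<exists>X y. X\<^sup>2 - y \<bullet> y = 1 \<and> z = krein_value a b\<^sub>1 b\<^sub>2 c\<^sub>1 c\<^sub>2 X y)" (is "?L \<longleftrightarrow> ?R")
proof
  have Q: "((cmod p)\<^sup>2 + (cmod q)\<^sup>2 + (cmod r)\<^sup>2)\<^sup>2
      - (2 * cnj q * p, 2 * cnj q * r) \<bullet> (2 * cnj q * p, 2 * cnj q * r)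
    = ((cmod p)\<^sup>2 - (cmod q)\<^sup>2 + (cmod r)\<^sup>2)\<^sup>2" for p q r
    by (simp add: inner_prod_def dot_square_norm norm_mult power_mult_distrib)
      (simp add: power2_eq_square algebra_simps)
  assume ?L
  then consider x where "krein_form J3 x x = 1"
      "z = krein_form J3 (tridiag3 a b\<^sub>1 b\<^sub>2 c\<^sub>1 c\<^sub>2 *v x) x"
    | x where "krein_form J3 x x = - 1"
      "z = - krein_form J3 (tridiag3 a b\<^sub>1 b\<^sub>2 c\<^sub>1 c\<^sub>2 *v x) x"
    unfolding krein_range_def krein_range_pos_def krein_range_neg_def by blast
  then show ?R
  proof cases
    case 1
    then have "(cmod (x $ 1))\<^sup>2 - (cmod (x $ 2))\<^sup>2 + (cmod (x $ 3))\<^sup>2 = 1"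
      unfolding krein_form_J3 by (metis of_real_eq_1_iff)
    then show ?thesis
      using Q[of "x $ 1" "x $ 2" "x $ 3"] 1(2) unfolding krein_form_tridiag3 by (metis one_power2)
  next
    case 2
    then have n: "(cmod (x $ 1))\<^sup>2 - (cmod (x $ 2))\<^sup>2 + (cmod (x $ 3))\<^sup>2 = - 1"
      unfolding krein_form_J3 by (metis of_real_eq_iff of_real_minus of_real_1)
    let ?X = "(cmod (x $ 1))\<^sup>2 + (cmod (x $ 2))\<^sup>2 + (cmod (x $ 3))\<^sup>2"
      and ?y = "(2 * cnj (x $ 2) * x $ 1, 2 * cnj (x $ 2) * x $ 3)"
    \<comment> \<open>Squaring hides the sign of [x, x], so the minus sign of the negative part can
      be moved into X and y.\<close>
    have "?X\<^sup>2 - ?y \<bullet> ?y = (- 1)\<^sup>2"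
      unfolding Q n ..
    then have "(- ?X)\<^sup>2 - (- ?y) \<bullet> (- ?y) = 1"
      by (simp only: power2_minus inner_minus_left inner_minus_right minus_minus one_power2)
    moreover have "z = krein_value a b\<^sub>1 b\<^sub>2 c\<^sub>1 c\<^sub>2 (- ?X) (- ?y)"
      unfolding krein_value_minus 2(2) krein_form_tridiag3 ..
    ultimately show ?thesis by blast
  qed
next
  assume ?R
  then obtain X y where Q: "X\<^sup>2 - y \<bullet> y = 1" and z: "z = krein_value a b\<^sub>1 b\<^sub>2 c\<^sub>1 c\<^sub>2 X y"
    by blast
  obtain y1 y3 where y: "y = (y1, y3)" by (cases y)
  have Q': "(cmod y1)\<^sup>2 + (cmod y3)\<^sup>2 = X\<^sup>2 - 1"
    using Q by (simp add: y inner_prod_def dot_square_norm)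
  then have "1 \<le> X\<^sup>2"
    using zero_le_power2[of "cmod y1"] zero_le_power2[of "cmod y3"] by linarith
  then have "1 \<le> \<bar>X\<bar>"
    using abs_le_square_iff[of 1 X] by simp
  then consider "X = 1" | "X > 1" | "X \<le> - 1"
    by linarith
  then show ?L
  proof cases
    case 1
    \<comment> \<open>At the vertex X = 1 the middle entry would be 0 and division by it fails, but
      y vanishes and the first unit vector serves.\<close>
    then have "y1 = 0" "y3 = 0" using Q' by (simp_all add: sum_power2_eq_zero_iff)
    then have "z = krein_form J3 (tridiag3 a b\<^sub>1 b\<^sub>2 c\<^sub>1 c\<^sub>2 *v vector [1, 0, 0]) (vector [1, 0, 0])"
      by (simp add: krein_form_tridiag3 z y 1)
    moreover have "krein_form J3 (vector [1, 0, 0]) (vector [1, 0, 0]) = 1"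
      by (simp add: krein_form_J3)
    ultimately show ?thesis
      unfolding krein_range_def krein_range_pos_def by blast
  next
    case 2
    \<comment> \<open>r is the middle entry forced by |x|^2 = X and [x, x] = 1.\<close>
    define r where "r = sqrt ((X - 1) / 2)"
    have r: "r > 0" "r\<^sup>2 = (X - 1) / 2" using 2 by (simp_all add: r_def)
    define x :: "complex^3" where "x = vector [y1 / of_real (2 * r), of_real r, y3 / of_real (2 * r)]"
    have n2: "(cmod (x $ 2))\<^sup>2 = (X - 1) / 2" using r by (simp add: x_def)
    have "(cmod (x $ 1))\<^sup>2 + (cmod (x $ 3))\<^sup>2 = ((cmod y1)\<^sup>2 + (cmod y3)\<^sup>2) / (4 * r\<^sup>2)"
      by (simp add: x_def norm_divide norm_mult power_divide power_mult_distrib add_divide_distrib)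
    also have "\<dots> = (X + 1) / 2"
      unfolding Q' r(2) using 2 by (simp add: field_simps power2_eq_square)
    finally have n13: "(cmod (x $ 1))\<^sup>2 + (cmod (x $ 3))\<^sup>2 = (X + 1) / 2" .
    have "(cmod (x $ 1))\<^sup>2 + (cmod (x $ 2))\<^sup>2 + (cmod (x $ 3))\<^sup>2 = X"
      using n2 n13 by argo
    moreover have "2 * cnj (x $ 2) * x $ 1 = y1" "2 * cnj (x $ 2) * x $ 3 = y3"
      using r by (simp_all add: x_def)
    ultimately have "z = krein_form J3 (tridiag3 a b\<^sub>1 b\<^sub>2 c\<^sub>1 c\<^sub>2 *v x) x"
      unfolding krein_form_tridiag3 by (simp add: z y)
    moreover have "(cmod (x $ 1))\<^sup>2 - (cmod (x $ 2))\<^sup>2 + (cmod (x $ 3))\<^sup>2 = 1"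
      using n2 n13 by argo
    then have "krein_form J3 x x = 1"
      unfolding krein_form_J3 by simp
    ultimately show ?thesis
      unfolding krein_range_def krein_range_pos_def by blast
  next
    case 3
    \<comment> \<open>Here |x|^2 = -X and [x, x] = -1, and the vector is built for -y.\<close>
    define r where "r = sqrt ((1 - X) / 2)"
    have r: "r > 0" "r\<^sup>2 = (1 - X) / 2" using 3 by (simp_all add: r_def)
    define x :: "complex^3" where
      "x = vector [- y1 / of_real (2 * r), of_real r, - y3 / of_real (2 * r)]"
    have n2: "(cmod (x $ 2))\<^sup>2 = (1 - X) / 2" using r by (simp add: x_def)
    have "(cmod (x $ 1))\<^sup>2 + (cmod (x $ 3))\<^sup>2 = ((cmod y1)\<^sup>2 + (cmod y3)\<^sup>2) / (4 * r\<^sup>2)"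
      by (simp add: x_def norm_divide norm_mult power_divide power_mult_distrib add_divide_distrib)
    also have "\<dots> = (- X - 1) / 2"
      unfolding Q' r(2) using 3 by (simp add: field_simps power2_eq_square)
    finally have n13: "(cmod (x $ 1))\<^sup>2 + (cmod (x $ 3))\<^sup>2 = (- X - 1) / 2" .
    have "(cmod (x $ 1))\<^sup>2 + (cmod (x $ 2))\<^sup>2 + (cmod (x $ 3))\<^sup>2 = - X"
      using n2 n13 by argo
    moreover have "2 * cnj (x $ 2) * x $ 1 = - y1" "2 * cnj (x $ 2) * x $ 3 = - y3"
      using r by (simp_all add: x_def)
    ultimately have "krein_form J3 (tridiag3 a b\<^sub>1 b\<^sub>2 c\<^sub>1 c\<^sub>2 *v x) x
        = krein_value a b\<^sub>1 b\<^sub>2 c\<^sub>1 c\<^sub>2 (- X) (- y)"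
      unfolding krein_form_tridiag3 by (simp add: y)
    then have "z = - krein_form J3 (tridiag3 a b\<^sub>1 b\<^sub>2 c\<^sub>1 c\<^sub>2 *v x) x"
      unfolding krein_value_minus z by simp
    moreover have "(cmod (x $ 1))\<^sup>2 - (cmod (x $ 2))\<^sup>2 + (cmod (x $ 3))\<^sup>2 = - 1"
      using n2 n13 by argo
    then have "krein_form J3 x x = - 1"
      unfolding krein_form_J3 by simp
    ultimately show ?thesis
      unfolding krein_range_def krein_range_neg_def by blast
  qed
qed

section \<open>Coordinate functionals of the range and their Gram matrix\<close>

definition re_vec :: "complex \<Rightarrow> complex \<Rightarrow> complex \<Rightarrow> complex \<Rightarrow> complex \<times> complex" where
  "re_vec b\<^sub>1 b\<^sub>2 c\<^sub>1 c\<^sub>2 = ((b\<^sub>1 - cnj c\<^sub>1) / 2, (c\<^sub>2 - cnj b\<^sub>2) / 2)"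

definition im_vec :: "complex \<Rightarrow> complex \<Rightarrow> complex \<Rightarrow> complex \<Rightarrow> complex \<times> complex" where
  "im_vec b\<^sub>1 b\<^sub>2 c\<^sub>1 c\<^sub>2 = (- \<i> * (b\<^sub>1 + cnj c\<^sub>1) / 2, - \<i> * (c\<^sub>2 + cnj b\<^sub>2) / 2)"

lemma Re_krein_value:
  "Re (krein_value a b\<^sub>1 b\<^sub>2 c\<^sub>1 c\<^sub>2 X y) = a * X + re_vec b\<^sub>1 b\<^sub>2 c\<^sub>1 c\<^sub>2 \<bullet> y"
  by (simp add: krein_value_def re_vec_def inner_prod_def inner_complex_def algebra_simps
      add_divide_distrib diff_divide_distrib)

text \<open>The summand \<open>0 * X\<close> gives the functional the shape expected by
  \<open>hyperboloid_image_iff\<close>, with \<beta> = 0.\<close>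

lemma Im_krein_value:
  "Im (krein_value a b\<^sub>1 b\<^sub>2 c\<^sub>1 c\<^sub>2 X y) = 0 * X + im_vec b\<^sub>1 b\<^sub>2 c\<^sub>1 c\<^sub>2 \<bullet> y"
  by (simp add: krein_value_def im_vec_def inner_prod_def inner_complex_def algebra_simps
      add_divide_distrib diff_divide_distrib)

text \<open>Up to sign and a factor 2 these are the coefficients of the conic factor of the
  determinant, so the boundary of the range and the curve get the same equation.\<close>

lemma gram_vecs:
  fixes a :: real and b\<^sub>1 b\<^sub>2 c\<^sub>1 c\<^sub>2 :: complex
  defines "\<Delta> \<equiv> (of_real a)\<^sup>2 + b\<^sub>1 * c\<^sub>1 + b\<^sub>2 * c\<^sub>2"
    and "N \<equiv> (cmod b\<^sub>1)\<^sup>2 + (cmod b\<^sub>2)\<^sup>2 + (cmod c\<^sub>1)\<^sup>2 + (cmod c\<^sub>2)\<^sup>2 - 2 * a\<^sup>2"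
  shows "a\<^sup>2 - re_vec b\<^sub>1 b\<^sub>2 c\<^sub>1 c\<^sub>2 \<bullet> re_vec b\<^sub>1 b\<^sub>2 c\<^sub>1 c\<^sub>2 = (2 * Re \<Delta> - N) / 4"
    and "- (re_vec b\<^sub>1 b\<^sub>2 c\<^sub>1 c\<^sub>2 \<bullet> im_vec b\<^sub>1 b\<^sub>2 c\<^sub>1 c\<^sub>2) = Im \<Delta> / 2"
    and "im_vec b\<^sub>1 b\<^sub>2 c\<^sub>1 c\<^sub>2 \<bullet> im_vec b\<^sub>1 b\<^sub>2 c\<^sub>1 c\<^sub>2 = (2 * Re \<Delta> + N) / 4"
  unfolding re_vec_def im_vec_def \<Delta>_def N_def cmod_power2
  by (simp_all add: inner_prod_def inner_complex_def power2_eq_square field_simps)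

text \<open>The Gram determinant is -1/16 of \<open>4 * (cmod \<Delta>)\<^sup>2 - N\<^sup>2\<close>,
  so the assumption says that the Gram matrix is indefinite. The pairs y range over a space of real
  dimension 4.\<close>

lemma krein_range_tridiag3_iff:
  fixes a :: real and b\<^sub>1 b\<^sub>2 c\<^sub>1 c\<^sub>2 :: complex
  defines "\<Delta> \<equiv> (of_real a)\<^sup>2 + b\<^sub>1 * c\<^sub>1 + b\<^sub>2 * c\<^sub>2"
    and "N \<equiv> (cmod b\<^sub>1)\<^sup>2 + (cmod b\<^sub>2)\<^sup>2 + (cmod c\<^sub>1)\<^sup>2 + (cmod c\<^sub>2)\<^sup>2 - 2 * a\<^sup>2"
  assumes N: "N\<^sup>2 < 4 * (cmod \<Delta>)\<^sup>2"
  shows "z \<in> krein_range J3 (tridiag3 a b\<^sub>1 b\<^sub>2 c\<^sub>1 c\<^sub>2) \<longleftrightarrow>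
         4 * (cmod \<Delta>)\<^sup>2 - N\<^sup>2 \<le> 4 * (N * (cmod z)\<^sup>2 + 2 * Re (cnj \<Delta> * z\<^sup>2))"
proof -
  let ?u = "re_vec b\<^sub>1 b\<^sub>2 c\<^sub>1 c\<^sub>2" and ?v = "im_vec b\<^sub>1 b\<^sub>2 c\<^sub>1 c\<^sub>2"
  define p b c where "p = (2 * Re \<Delta> - N) / 4" and "b = Im \<Delta> / 2" and "c = - (2 * Re \<Delta> + N) / 4"
  have g: "p = a\<^sup>2 - ?u \<bullet> ?u" "b = a * 0 - ?u \<bullet> ?v" "c = 0\<^sup>2 - ?v \<bullet> ?v"
    using gram_vecs[where a = a and b\<^sub>1 = b\<^sub>1 and b\<^sub>2 = b\<^sub>2 and c\<^sub>1 = c\<^sub>1 and c\<^sub>2 = c\<^sub>2] unfolding p_def b_def c_def \<Delta>_def N_def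
    by simp_all
  have scale: "k \<le> d \<longleftrightarrow> 16 * (- d) \<le> - 16 * k" for k d :: real
    by linarith
  have disc: "16 * (b\<^sup>2 - p * c) = 4 * (cmod \<Delta>)\<^sup>2 - N\<^sup>2"
    unfolding p_def b_def c_def cmod_power2 by (simp add: field_simps power2_eq_square)
  have "z \<in> krein_range J3 (tridiag3 a b\<^sub>1 b\<^sub>2 c\<^sub>1 c\<^sub>2) \<longleftrightarrow>
      (\<exists>X y. X\<^sup>2 - y \<bullet> y = 1 \<and> a * X + ?u \<bullet> y = Re z \<and> 0 * X + ?v \<bullet> y = Im z)"
    unfolding krein_range_tridiag3 complex_eq_iff Re_krein_value Im_krein_value by metis
  also have "\<dots> \<longleftrightarrow> c * (Re z)\<^sup>2 - 2 * b * Re z * Im z + p * (Im z)\<^sup>2 \<le> p * c - b\<^sup>2"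
  proof (rule hyperboloid_image_iff[OF _ g])
    show "p * c < b\<^sup>2" using N disc by simp
  qed simp
  also have "\<dots> \<longleftrightarrow> 16 * (b\<^sup>2 - p * c) \<le>
      - 16 * (c * (Re z)\<^sup>2 - 2 * b * Re z * Im z + p * (Im z)\<^sup>2)"
    using scale[of _ "p * c - b\<^sup>2"] by (simp only: minus_diff_eq)
  also have "- 16 * (c * (Re z)\<^sup>2 - 2 * b * Re z * Im z + p * (Im z)\<^sup>2)
      = 4 * (N * (cmod z)\<^sup>2 + 2 * Re (cnj \<Delta> * z\<^sup>2))"
    unfolding p_def b_def c_def cmod_power2 by (simp add: field_simps power2_eq_square)
  finally show ?thesis unfolding disc .
qed

section \<open>Duals of reducible cubics\<close>

lemma eval3_add [simp]: "eval3 (F + G) q = eval3 F q + eval3 G q"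
  and eval3_diff [simp]: "eval3 (F - G) q = eval3 F q - eval3 G q"
  and eval3_mult [simp]: "eval3 (F * G) q = eval3 F q * eval3 G q"
  and eval3_power [simp]: "eval3 (F ^ n) q = eval3 F q ^ n"
  and eval3_const3 [simp]: "eval3 (const3 k) q = k"
  and eval3_var_u [simp]: "eval3 var_u q = q $ 1"
  and eval3_var_v [simp]: "eval3 var_v q = q $ 2"
  and eval3_var_w [simp]: "eval3 var_w q = q $ 3"
  by (simp_all add: eval3_def const3_def var_u_def var_v_def var_w_def)

lemma const3_mult_eq: "const3 k * F = smult [:[:k:]:] F"
  by (simp add: const3_def)

lemma is_unit_poly3_obtain:
  assumes "is_unit (e :: poly3)"
  obtains k where "k \<noteq> 0" "e = const3 k"
proof -
  obtain e2 where e2: "e = [:e2:]" "is_unit e2"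
    using assms is_unit_poly_iff by blast
  obtain e1 where e1: "e2 = [:e1:]" "is_unit e1"
    using e2(2) is_unit_poly_iff by blast
  obtain k where k: "e1 = [:k:]" "k dvd 1"
    using e1(2) is_unit_poly_iff by blast
  show thesis
  proof (rule that)
    show "k \<noteq> 0" using k(2) by (simp add: dvd_field_iff)
    show "e = const3 k" by (simp only: const3_def e2(1) e1(1) k(1))
  qed
qed

lemma grad3_const3_mult: "grad3 (const3 k * F) q = k *s grad3 F q"
proof -
  have 2: "map_poly pderiv (smult [:k:] H) = smult [:k:] (map_poly pderiv H)"
    for H :: "complex poly poly"
    by (intro poly_eqI) (simp add: coeff_map_poly pderiv_smult)
  have 1: "map_poly pderiv (const3 k * F) = const3 k * map_poly pderiv F"
    unfolding const3_mult_eq by (intro poly_eqI) (simp add: coeff_map_poly pderiv_smult)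
  have 3: "map_poly (map_poly pderiv) (const3 k * F) = const3 k * map_poly (map_poly pderiv) F"
    unfolding const3_mult_eq by (intro poly_eqI) (simp add: coeff_map_poly 2)
  have 4: "pderiv (const3 k * F) = const3 k * pderiv F"
    unfolding const3_mult_eq by (simp add: pderiv_smult)
  show ?thesis
    unfolding grad3_def 1 3 4 by (simp add: vec_eq_iff forall_3)
qed

definition tangent_cone :: "poly3 \<Rightarrow> (complex^3) set" where
  "tangent_cone F = {t *s grad3 F p | t p. p \<noteq> 0 \<and> eval3 F p = 0}"

text \<open>The free factor t in the cone absorbs the scaling of the gradient, so associated
  polynomials have the same dual.\<close>

lemma tangent_cone_const3_mult:
  assumes "k \<noteq> 0"
  shows "tangent_cone (const3 k * F) = tangent_cone F"
proof -
  have "tangent_cone (const3 k * F) = {(t * k) *s grad3 F p | t p. p \<noteq> 0 \<and> eval3 F p = 0}"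
    using assms by (simp add: tangent_cone_def grad3_const3_mult)
  also have "\<dots> = tangent_cone F"
    unfolding tangent_cone_def
  proof (intro equalityI subsetI)
    fix q assume "q \<in> {t *s grad3 F p | t p. p \<noteq> 0 \<and> eval3 F p = 0}"
    then obtain t p where "q = ((t / k) * k) *s grad3 F p" "p \<noteq> 0 \<and> eval3 F p = 0"
      using assms by auto
    then show "q \<in> {(t * k) *s grad3 F p | t p. p \<noteq> 0 \<and> eval3 F p = 0}"
      by blast
  qed blast
  finally show ?thesis .
qed

text \<open>The dual runs over all irreducible divisors P. The prime L divides P or its cofactor,
  and cancelling it makes P associated to L or to Q; primality of one factor thus replaces unique
  factorization.\<close>

lemma dual_curve_cone_prime_mult_irreducible:
  assumes "prime_elem L" "irreducible Q"
  shows "dual_curve_cone (L * Q) =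
         zariski_closure (tangent_cone L) \<union> zariski_closure (tangent_cone Q)"
proof -
  have L: "irreducible L" using assms(1) by (rule prime_elem_imp_irreducible)
  have unit: "tangent_cone (P * e) = tangent_cone P" if "is_unit e" for P e
    using that by (metis is_unit_poly3_obtain mult.commute tangent_cone_const3_mult)
  have key: "tangent_cone P = tangent_cone L \<or> tangent_cone P = tangent_cone Q"
    if P: "irreducible P" and dvd: "P dvd L * Q" for P
  proof -
    obtain K where K: "L * Q = P * K" using dvd by (rule dvdE)
    then have "L dvd P \<or> L dvd K"
      using assms(1) by (metis dvd_triv_left prime_elem_dvd_mult_iff)
    then show ?thesis
    proof
      assume "L dvd P"
      then obtain e where e: "P = L * e" by (rule dvdE)
      then have "is_unit e" using P L by (meson irreducibleD irreducible_not_unit)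
      then show ?thesis using e unit by simp
    next
      assume "L dvd K"
      then obtain e where e: "K = L * e" by (rule dvdE)
      have "L \<noteq> 0" using L by auto
      then have Q: "Q = P * e" using K e by (simp add: mult.left_commute)
      then have "is_unit e" using P assms(2) by (meson irreducibleD irreducible_not_unit)
      then show ?thesis using Q unit by metis
    qed
  qed
  have "dual_curve_cone (L * Q) =
      (\<Union>P\<in>{P. irreducible P \<and> P dvd L * Q}. zariski_closure (tangent_cone P))"
    unfolding dual_curve_cone_def tangent_cone_def ..
  also have "\<dots> = zariski_closure (tangent_cone L) \<union> zariski_closure (tangent_cone Q)"
  proof (intro equalityI subsetI)
    fix q assume "q \<in> zariski_closure (tangent_cone L) \<union> zariski_closure (tangent_cone Q)"
    moreover have "L dvd L * Q" "Q dvd L * Q" by simp_all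
    ultimately show "q \<in> (\<Union>P\<in>{P. irreducible P \<and> P dvd L * Q}. zariski_closure (tangent_cone P))"
      using L assms(2) by blast
  next
    fix q assume "q \<in> (\<Union>P\<in>{P. irreducible P \<and> P dvd L * Q}. zariski_closure (tangent_cone P))"
    then show "q \<in> zariski_closure (tangent_cone L) \<union> zariski_closure (tangent_cone Q)"
      using key by force
  qed
  finally show ?thesis .
qed

lemma tangent_coneI: "p \<noteq> 0 \<Longrightarrow> eval3 F p = 0 \<Longrightarrow> grad3 F p \<in> tangent_cone F"
  unfolding tangent_cone_def by (force intro: exI[of _ 1])

lemma subset_zariski_closure: "S \<subseteq> zariski_closure S"
  by (auto simp: zariski_closure_def)

lemma zariski_closureD:
  assumes "q \<in> zariski_closure S" "\<And>s. s \<in> S \<Longrightarrow> eval3 G s = 0"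
  shows "eval3 G q = 0"
  using assms by (auto simp: zariski_closure_def)

section \<open>Irreducibility of the linear and the quadratic factor\<close>

lemma prime_elem_monic_linear:
  fixes c :: "'a::idom_divide"
  shows "prime_elem [:c, 1:]"
proof (rule prime_elemI)
  show "\<not> is_unit [:c, 1:]"
    by (auto simp: is_unit_poly_iff)
  have dvd_iff: "[:c, 1:] dvd f \<longleftrightarrow> poly f (- c) = 0" for f
    using poly_eq_0_iff_dvd[of f "- c"] by simp
  show "[:c, 1:] dvd f \<or> [:c, 1:] dvd g" if "[:c, 1:] dvd f * g" for f g
    using that unfolding dvd_iff by simp
qed simp

text \<open>Leading coefficients of the factors are mutually inverse, so a factor of degree 0 is a
  unit, and two linear factors would exhibit -q as a square.\<close>

lemma irreducible_monic_quadratic: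
  fixes q :: "'a::idom_divide"
  assumes "\<And>r. q \<noteq> - r\<^sup>2"
  shows "irreducible [:q, 0, 1:]"
proof (rule irreducibleI)
  show "\<not> is_unit [:q, 0, 1:]"
    by (auto simp: is_unit_poly_iff)
  fix f g assume fg: "[:q, 0, 1:] = f * g"
  have nz: "f \<noteq> 0" "g \<noteq> 0" using fg by auto
  have deg: "degree f + degree g = 2"
    using fg degree_mult_eq[OF nz] by (metis degree_pCons_eq_if one_neq_zero pCons_eq_0_iff degree_0 numeral_2_eq_2 degree_1 one_pCons)
  have lc: "lead_coeff f * lead_coeff g = 1"
    by (metis fg lead_coeff_mult lead_coeff_pCons(1) lead_coeff_1 one_pCons pCons_eq_0_iff one_neq_zero)
  consider "degree f = 0" | "degree g = 0" | "degree f = 1" "degree g = 1"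
    using deg by linarith
  then show "is_unit f \<or> is_unit g"
  proof cases
    case 1
    then obtain k where "f = [:k:]" by (rule degree_eq_zeroE)
    then show ?thesis using lc by (auto simp: is_unit_poly_iff intro: dvdI[of 1 _ "lead_coeff g"])
  next
    case 2
    then obtain k where "g = [:k:]" by (rule degree_eq_zeroE)
    then show ?thesis using lc by (auto simp: is_unit_poly_iff intro: dvdI[of 1 _ "lead_coeff f"] simp: mult.commute)
  next
    case 3
    obtain f0 f1 where f: "f = [:f0, f1:]" using degree1_coeffs[OF 3(1)] by blast
    obtain g0 g1 where g: "g = [:g0, g1:]" using degree1_coeffs[OF 3(2)] by blast
    have "f1 * g1 = 1" "f0 * g1 + f1 * g0 = 0" "q = f0 * g0"
      using fg by (simp_all add: f g algebra_simps)
    \<comment> \<open>Insert f1 g1 = 1 into f0 g0 and regroup as (f0 g1)(f1 g0), whose factors are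
      opposite.\<close>
    then have "q = - (f0 * g1)\<^sup>2" by algebra
    then show ?thesis using assms by blast
  qed
qed simp

definition line_poly :: "complex \<Rightarrow> poly3" where
  "line_poly \<alpha> = [:[:[:0, \<alpha>:]:], 1:]"

text \<open>This is w^2 - p u^2 - r u v + t v^2, written as a monic quadratic in the outermost
  variable w to fit the irreducibility criterion.\<close>

definition conic_poly :: "complex \<Rightarrow> complex \<Rightarrow> complex \<Rightarrow> poly3" where
  "conic_poly p r t = [:[:[:0, 0, - p:], [:0, - r:], [:t:]:], 0, 1:]"

lemma prime_elem_line_poly: "prime_elem (line_poly \<alpha>)"
  unfolding line_poly_def by (rule prime_elem_monic_linear)

lemma irreducible_conic_poly:
  assumes "4 * p * t + r\<^sup>2 \<noteq> 0"
  shows "irreducible (conic_poly p r t)"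
  unfolding conic_poly_def
proof (rule irreducible_monic_quadratic, rule notI)
  fix s :: "complex poly poly"
  assume eq: "[:[:0, 0, - p:], [:0, - r:], [:t:]:] = - s\<^sup>2"
  have "degree (- s\<^sup>2) \<le> 2"
    unfolding eq[symmetric] by simp
  then have "degree s \<le> 1"
    by (cases "s = 0") (simp_all add: power2_eq_square degree_mult_eq)
  then have "s = [:coeff s 0, coeff s 1:]"
    by (intro poly_eqI) (auto simp: coeff_pCons coeff_eq_0 split: nat.split)
  then obtain s0 s1 where s: "s = [:s0, s1:]" by blast
  have "[:0, 0, - p:] = - (s0 * s0)" "[:0, - r:] = - (2 * (s0 * s1))" "[:t:] = - (s1 * s1)"
    using eq by (simp_all add: s power2_eq_square)
  \<comment> \<open>Eliminating s0 and s1 says that the binary form in u and v has discriminant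
    zero; the coefficient of u^2 carries this.\<close>
  then have "[:0, - r:]\<^sup>2 = 4 * [:0, 0, - p:] * [:t:]"
    by algebra
  then have "coeff ([:0, - r:]\<^sup>2) 2 = coeff (4 * [:0, 0, - p:] * [:t:]) 2"
    by simp
  then have "r\<^sup>2 = - (4 * p * t)"
    by (simp add: power2_eq_square numeral_poly numeral_2_eq_2)
  then show False using assms by simp
qed

section \<open>Tangents of the two factors and their closures\<close>

lemma eval3_line_poly: "eval3 (line_poly \<alpha>) q = \<alpha> * q $ 1 + q $ 3"
  by (simp add: eval3_def line_poly_def)

lemma map_poly_pderiv_1: "map_poly pderiv 1 = 0"
  by (intro poly_eqI) (simp add: coeff_map_poly coeff_1)

lemma grad3_line_poly: "grad3 (line_poly \<alpha>) q = vector [\<alpha>, 0, 1]"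
  by (simp add: grad3_def eval3_def line_poly_def map_poly_pCons pderiv_pCons map_poly_pderiv_1)

lemma eval3_conic_poly:
  "eval3 (conic_poly p r t) q = (q $ 3)\<^sup>2 - p * (q $ 1)\<^sup>2 - r * q $ 1 * q $ 2 + t * (q $ 2)\<^sup>2"
  by (simp add: eval3_def conic_poly_def power2_eq_square algebra_simps)

lemma grad3_conic_poly:
  "grad3 (conic_poly p r t) q =
   vector [- 2 * p * q $ 1 - r * q $ 2, - r * q $ 1 + 2 * t * q $ 2, 2 * q $ 3]"
  by (simp add: grad3_def eval3_def conic_poly_def map_poly_pCons pderiv_pCons map_poly_pderiv_1 vec_eq_iff forall_3 algebra_simps)

text \<open>The gradient is constant, so the cone is one line through the origin, cut out by the
  linear forms v and u - \<alpha> w.\<close>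

lemma zariski_closure_line_poly:
  "vector [x, y, 1] \<in> zariski_closure (tangent_cone (line_poly \<alpha>)) \<longleftrightarrow> x = \<alpha> \<and> y = 0"
proof
  assume q: "vector [x, y, 1] \<in> zariski_closure (tangent_cone (line_poly \<alpha>))"
  have "eval3 var_v (vector [x, y, 1]) = 0"
    by (rule zariski_closureD[OF q]) (auto simp: tangent_cone_def grad3_line_poly)
  moreover have "eval3 (var_u - const3 \<alpha> * var_w) (vector [x, y, 1]) = 0"
    by (rule zariski_closureD[OF q]) (auto simp: tangent_cone_def grad3_line_poly)
  ultimately show "x = \<alpha> \<and> y = 0" by simp
next
  assume "x = \<alpha> \<and> y = 0"
  then have "vector [x, y, 1] = grad3 (line_poly \<alpha>) (vector [0, 1, 0])"
    by (simp add: grad3_line_poly)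
  moreover have "(vector [0, 1, 0] :: complex^3) \<noteq> 0"
    by (simp add: vec_eq_iff forall_3)
  ultimately have "vector [x, y, 1] \<in> tangent_cone (line_poly \<alpha>)"
    by (metis tangent_coneI eval3_line_poly vector_3 mult_zero_right add_0)
  then show "vector [x, y, 1] \<in> zariski_closure (tangent_cone (line_poly \<alpha>))"
    using subset_zariski_closure by blast
qed

lemma zariski_closure_conic_poly:
  assumes "4 * p * t + r\<^sup>2 \<noteq> 0"
  shows "vector [x, y, 1] \<in> zariski_closure (tangent_cone (conic_poly p r t)) \<longleftrightarrow>
         4 * (t * x\<^sup>2 + r * x * y - p * y\<^sup>2) = 4 * p * t + r\<^sup>2"
proof
  assume q: "vector [x, y, 1] \<in> zariski_closure (tangent_cone (conic_poly p r t))"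
  \<comment> \<open>The equation of the dual conic, from the adjugate of the matrix of the conic; it
    vanishes on all tangents and therefore on their closure.\<close>
  have "eval3 (const3 4 * (const3 t * var_u\<^sup>2 + const3 r * var_u * var_v - const3 p * var_v\<^sup>2)
               - const3 (4 * p * t + r\<^sup>2) * var_w\<^sup>2) (vector [x, y, 1]) = 0"
  proof (rule zariski_closureD[OF q])
    fix s assume "s \<in> tangent_cone (conic_poly p r t)"
    then obtain k q where s: "s = k *s grad3 (conic_poly p r t) q"
      and q: "eval3 (conic_poly p r t) q = 0"
      by (auto simp: tangent_cone_def)
    have *: "(q $ 3)\<^sup>2 = p * (q $ 1)\<^sup>2 + r * q $ 1 * q $ 2 - t * (q $ 2)\<^sup>2"
      using q by (simp add: eval3_conic_poly algebra_simps)
    have "s $ 1 = k * (- 2 * p * q $ 1 - r * q $ 2)" "s $ 2 = k * (- r * q $ 1 + 2 * t * q $ 2)"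
      "s $ 3 = k * (2 * q $ 3)"
      by (simp_all add: s grad3_conic_poly)
    with * have "4 * (t * (s $ 1)\<^sup>2 + r * s $ 1 * s $ 2 - p * (s $ 2)\<^sup>2)
        - (4 * p * t + r\<^sup>2) * (s $ 3)\<^sup>2 = 0"
      by algebra
    then show "eval3 (const3 4 * (const3 t * var_u\<^sup>2 + const3 r * var_u * var_v - const3 p * var_v\<^sup>2)
               - const3 (4 * p * t + r\<^sup>2) * var_w\<^sup>2) s = 0"
      by simp
  qed
  then show "4 * (t * x\<^sup>2 + r * x * y - p * y\<^sup>2) = 4 * p * t + r\<^sup>2"
    by simp
next
  assume eq: "4 * (t * x\<^sup>2 + r * x * y - p * y\<^sup>2) = 4 * p * t + r\<^sup>2"
  define D where "D = 4 * p * t + r\<^sup>2"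
  have D: "D \<noteq> 0" using assms by (simp add: D_def)
  \<comment> \<open>The point of contact: q1 and q2 solve the linear system gradient = (x, y, 1), of
    determinant -D, and the third coordinate 1/2 gives the last entry 1.\<close>
  define q1 where "q1 = - (2 * t * x + r * y) / D"
  define q2 where "q2 = (2 * p * y - r * x) / D"
  have q1: "q1 * D = - (2 * t * x + r * y)" and q2: "q2 * D = 2 * p * y - r * x"
    using D by (simp_all add: q1_def q2_def)
  define q :: "complex^3" where "q = vector [q1, q2, 1 / 2]"
  have "(- 2 * p * q1 - r * q2) * D = x * D" "(- r * q1 + 2 * t * q2) * D = y * D"
    using q1 q2 unfolding D_def by algebra+
  then have x: "- 2 * p * q1 - r * q2 = x" and y: "- r * q1 + 2 * t * q2 = y"
    using D by simp_all
  have "vector [x, y, 1] = grad3 (conic_poly p r t) q"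
    using x y by (simp add: grad3_conic_poly q_def)
  moreover have "q \<noteq> 0"
    by (simp add: q_def vec_eq_iff forall_3)
  moreover have "4 * eval3 (conic_poly p r t) q = 0"
  proof -
    have "(1 - 4 * (p * q1\<^sup>2 + r * q1 * q2 - t * q2\<^sup>2)) * D = 0"
      using eq unfolding x[symmetric] y[symmetric] D_def by algebra
    then have "1 - 4 * (p * q1\<^sup>2 + r * q1 * q2 - t * q2\<^sup>2) = 0"
      using D by simp
    then show ?thesis
      by (simp add: eval3_conic_poly q_def power2_eq_square algebra_simps)
  qed
  ultimately have "vector [x, y, 1] \<in> tangent_cone (conic_poly p r t)"
    using tangent_coneI[of q "conic_poly p r t"] by simp
  then show "vector [x, y, 1] \<in> zariski_closure (tangent_cone (conic_poly p r t))"
    using subset_zariski_closure by blast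
qed

lemma dual_curve_cone_line_conic:
  assumes "4 * p * t + r\<^sup>2 \<noteq> 0"
  shows "vector [x, y, 1] \<in> dual_curve_cone (line_poly \<alpha> * conic_poly p r t) \<longleftrightarrow>
         (x = \<alpha> \<and> y = 0) \<or> 4 * (t * x\<^sup>2 + r * x * y - p * y\<^sup>2) = 4 * p * t + r\<^sup>2"
  using dual_curve_cone_prime_mult_irreducible[OF prime_elem_line_poly irreducible_conic_poly[OF assms]]
  by (simp add: zariski_closure_line_poly zariski_closure_conic_poly[OF assms])

section \<open>The boundary generating curve\<close>

lemma krein_adjoint_tridiag3:
  "krein_adjoint J3 (tridiag3 a b\<^sub>1 b\<^sub>2 c\<^sub>1 c\<^sub>2) =
   vector [vector [of_real a, - cnj c\<^sub>1, 0], vector [- cnj b\<^sub>1, - of_real a, - cnj c\<^sub>2],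
     vector [0, - cnj b\<^sub>2, of_real a]]"
  by (simp add: krein_adjoint_def conj_transpose_def matrix_matrix_mult_def vec_eq_iff forall_3 sum_3)

text \<open>The value is \<open>a\<^sup>2 - N\<close>, which turns the trace condition into |N| < 2
  |\<Delta>|.\<close>

lemma trace_krein_adjoint_tridiag3:
  "Re (trace (krein_adjoint J3 (tridiag3 a b\<^sub>1 b\<^sub>2 c\<^sub>1 c\<^sub>2) ** tridiag3 a b\<^sub>1 b\<^sub>2 c\<^sub>1 c\<^sub>2)) =
   3 * a\<^sup>2 - ((cmod b\<^sub>1)\<^sup>2 + (cmod b\<^sub>2)\<^sup>2 + (cmod c\<^sub>1)\<^sup>2 + (cmod c\<^sub>2)\<^sup>2)"
  unfolding krein_adjoint_tridiag3 cmod_power2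
  by (simp add: trace_def matrix_matrix_mult_def sum_3 power2_eq_square)

text \<open>The first and third diagonal entries of the tridiagonal pencil are both a u + w, so this
  factor splits off the determinant.\<close>

lemma krein_poly_tridiag3:
  fixes a :: real and b\<^sub>1 b\<^sub>2 c\<^sub>1 c\<^sub>2 :: complex
  defines "\<Delta> \<equiv> (of_real a)\<^sup>2 + b\<^sub>1 * c\<^sub>1 + b\<^sub>2 * c\<^sub>2"
    and "N \<equiv> (cmod b\<^sub>1)\<^sup>2 + (cmod b\<^sub>2)\<^sup>2 + (cmod c\<^sub>1)\<^sup>2 + (cmod c\<^sub>2)\<^sup>2 - 2 * a\<^sup>2"
  shows "krein_poly J3 (tridiag3 a b\<^sub>1 b\<^sub>2 c\<^sub>1 c\<^sub>2) =
    line_poly (of_real a) * conic_poly (of_real ((2 * Re \<Delta> - N) / 4)) (of_real (Im \<Delta>))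
      (of_real ((2 * Re \<Delta> + N) / 4))"
proof -
  \<comment> \<open>Opaque names for the off-diagonal entries make the determinant a plain
    polynomial identity; conjugates matter only when the three coefficients are identified.\<close>
  define r12 r21 r23 r32 where r: "r12 = (b\<^sub>1 - cnj c\<^sub>1) / 2" "r21 = (c\<^sub>1 - cnj b\<^sub>1) / 2"
    "r23 = (b\<^sub>2 - cnj c\<^sub>2) / 2" "r32 = (c\<^sub>2 - cnj b\<^sub>2) / 2"
  define i12 i21 i23 i32 where i: "i12 = (b\<^sub>1 + cnj c\<^sub>1) / (2 * \<i>)" "i21 = (c\<^sub>1 + cnj b\<^sub>1) / (2 * \<i>)"
    "i23 = (b\<^sub>2 + cnj c\<^sub>2) / (2 * \<i>)" "i32 = (c\<^sub>2 + cnj b\<^sub>2) / (2 * \<i>)"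
  have Re: "krein_Re J3 (tridiag3 a b\<^sub>1 b\<^sub>2 c\<^sub>1 c\<^sub>2) =
      vector [vector [of_real a, r12, 0], vector [r21, - of_real a, r23], vector [0, r32, of_real a]]"
    unfolding krein_Re_def krein_adjoint_tridiag3
    by (simp add: vec_eq_iff forall_3 r)
  have Im: "krein_Im J3 (tridiag3 a b\<^sub>1 b\<^sub>2 c\<^sub>1 c\<^sub>2) =
      vector [vector [0, i12, 0], vector [i21, 0, i23], vector [0, i32, 0]]"
    unfolding krein_Im_def krein_adjoint_tridiag3
    by (simp add: vec_eq_iff forall_3 i)
  have p: "of_real ((2 * Re \<Delta> - N) / 4) = (of_real a)\<^sup>2 + r12 * r21 + r23 * r32"
    unfolding \<Delta>_def N_def cmod_power2
    by (simp add: complex_eq_iff r power2_eq_square field_simps)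
  have q: "of_real (Im \<Delta>) = r12 * i21 + i12 * r21 + r23 * i32 + i23 * r32"
    unfolding \<Delta>_def by (simp add: complex_eq_iff r i field_simps power2_eq_square)
  have t: "of_real ((2 * Re \<Delta> + N) / 4) = - (i12 * i21 + i23 * i32)"
    unfolding \<Delta>_def N_def cmod_power2
    by (simp add: complex_eq_iff i power2_eq_square field_simps)
  show ?thesis
    unfolding krein_poly_def Re Im p q t
    by (simp add: det_3 mat_def var_u_def var_v_def var_w_def const3_def line_poly_def conic_poly_def
        algebra_simps power2_eq_square)
qed

text \<open>The difference of the two sides of the assumption is, up to sign and a factor 4, the
  discriminant of the conic, so irreducibility and duality apply whatever its sign.\<close>

lemma krein_curve_tridiag3_iff:
  fixes a :: real and b\<^sub>1 b\<^sub>2 c\<^sub>1 c\<^sub>2 :: complex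
  defines "\<Delta> \<equiv> (of_real a)\<^sup>2 + b\<^sub>1 * c\<^sub>1 + b\<^sub>2 * c\<^sub>2"
    and "N \<equiv> (cmod b\<^sub>1)\<^sup>2 + (cmod b\<^sub>2)\<^sup>2 + (cmod c\<^sub>1)\<^sup>2 + (cmod c\<^sub>2)\<^sup>2 - 2 * a\<^sup>2"
  assumes N: "N\<^sup>2 \<noteq> 4 * (cmod \<Delta>)\<^sup>2"
  shows "z \<in> krein_curve J3 (tridiag3 a b\<^sub>1 b\<^sub>2 c\<^sub>1 c\<^sub>2) \<longleftrightarrow>
         z = of_real a \<or> 4 * (N * (cmod z)\<^sup>2 + 2 * Re (cnj \<Delta> * z\<^sup>2)) = 4 * (cmod \<Delta>)\<^sup>2 - N\<^sup>2"
proof -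
  define p r t where "p = (2 * Re \<Delta> - N) / 4" and "r = Im \<Delta>" and "t = (2 * Re \<Delta> + N) / 4"
  let ?x = "complex_of_real (Re z)" and ?y = "complex_of_real (Im z)"
  have disc: "4 * (4 * p * t + r\<^sup>2) = 4 * (cmod \<Delta>)\<^sup>2 - N\<^sup>2"
    unfolding p_def r_def t_def cmod_power2 by (simp add: field_simps power2_eq_square)
  have level: "4 * (4 * (t * (Re z)\<^sup>2 + r * Re z * Im z - p * (Im z)\<^sup>2))
      = 4 * (N * (cmod z)\<^sup>2 + 2 * Re (cnj \<Delta> * z\<^sup>2))"
    unfolding p_def r_def t_def cmod_power2 by (simp add: field_simps power2_eq_square)
  have nz: "4 * complex_of_real p * of_real t + (of_real r)\<^sup>2 \<noteq> 0"
  proof -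
    have "4 * complex_of_real p * of_real t + (of_real r)\<^sup>2 = of_real (4 * p * t + r\<^sup>2)" by simp
    moreover have "4 * p * t + r\<^sup>2 \<noteq> 0" using disc N by auto
    ultimately show ?thesis by (metis of_real_eq_0_iff)
  qed
  have "z \<in> krein_curve J3 (tridiag3 a b\<^sub>1 b\<^sub>2 c\<^sub>1 c\<^sub>2) \<longleftrightarrow>
      vector [?x, ?y, 1] \<in> dual_curve_cone (krein_poly J3 (tridiag3 a b\<^sub>1 b\<^sub>2 c\<^sub>1 c\<^sub>2))"
    by (cases z) (auto simp: krein_curve_def)
  also have "\<dots> \<longleftrightarrow> (?x = of_real a \<and> ?y = 0) \<or>
      4 * (of_real t * ?x\<^sup>2 + of_real r * ?x * ?y - of_real p * ?y\<^sup>2)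
        = 4 * of_real p * of_real t + (of_real r)\<^sup>2"
    unfolding krein_poly_tridiag3 \<Delta>_def[symmetric] N_def[symmetric]
      p_def[symmetric] r_def[symmetric] t_def[symmetric]
    by (rule dual_curve_cone_line_conic[OF nz])
  also have "?x = of_real a \<and> ?y = 0 \<longleftrightarrow> z = of_real a"
    by (simp add: complex_eq_iff)
  also have "4 * (of_real t * ?x\<^sup>2 + of_real r * ?x * ?y - of_real p * ?y\<^sup>2)
        = 4 * of_real p * of_real t + (of_real r)\<^sup>2 \<longleftrightarrow>
      complex_of_real (4 * (t * (Re z)\<^sup>2 + r * Re z * Im z - p * (Im z)\<^sup>2)) = of_real (4 * p * t + r\<^sup>2)"
    by simp
  also have "\<dots> \<longleftrightarrow> 4 * (4 * (t * (Re z)\<^sup>2 + r * Re z * Im z - p * (Im z)\<^sup>2)) = 4 * (4 * p * t + r\<^sup>2)"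
    unfolding of_real_eq_iff mult_cancel_left by simp
  finally show ?thesis
    unfolding level disc .
qed

theorem theorem3p1:
  fixes a :: real and b\<^sub>1 b\<^sub>2 c\<^sub>1 c\<^sub>2 \<Delta> :: complex and J A :: "complex^3^3" and l :: real
  assumes J: "J = vector [vector [1, 0, 0], vector [0, -1, 0], vector [0, 0, 1]]"
    and A: "A = vector [vector [of_real a, b\<^sub>1, 0],
                        vector [c\<^sub>1, - of_real a, b\<^sub>2],
                        vector [0, c\<^sub>2, of_real a]]"
    and \<Delta>: "\<Delta> = (of_real a)\<^sup>2 + b\<^sub>1 * c\<^sub>1 + b\<^sub>2 * c\<^sub>2"
    and l: "l = sqrt (2 * cmod \<Delta> - 2 * a\<^sup>2
                 + (cmod b\<^sub>1)\<^sup>2 + (cmod b\<^sub>2)\<^sup>2 + (cmod c\<^sub>1)\<^sup>2 + (cmod c\<^sub>2)\<^sup>2)"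
  shows "((\<exists>H. nondegenerate_hyperbolic_disc (krein_range J A) H (csqrt \<Delta>) (- csqrt \<Delta>) l) \<longleftrightarrow>
           a\<^sup>2 - 2 * cmod \<Delta> < Re (trace (krein_adjoint J A ** A)) \<and>
           Re (trace (krein_adjoint J A ** A)) < a\<^sup>2 + 2 * cmod \<Delta>) \<and>
         (\<forall>H. nondegenerate_hyperbolic_disc (krein_range J A) H (csqrt \<Delta>) (- csqrt \<Delta>) l \<longrightarrow>
           krein_curve J A = H \<union> {complex_of_real a})"
proof -
  define N where "N = (cmod b\<^sub>1)\<^sup>2 + (cmod b\<^sub>2)\<^sup>2 + (cmod c\<^sub>1)\<^sup>2 + (cmod c\<^sub>2)\<^sup>2 - 2 * a\<^sup>2"
  have l': "l = sqrt (2 * cmod \<Delta> + N)"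
    unfolding l N_def by (simp add: algebra_simps)
  have ineq: "a\<^sup>2 - 2 * cmod \<Delta> < Re (trace (krein_adjoint J A ** A)) \<and>
      Re (trace (krein_adjoint J A ** A)) < a\<^sup>2 + 2 * cmod \<Delta> \<longleftrightarrow> \<bar>N\<bar> < 2 * cmod \<Delta>"
    unfolding J A trace_krein_adjoint_tridiag3 N_def by linarith
  have focal: "(dist (csqrt \<Delta>) (- csqrt \<Delta>) / 2)\<^sup>2 = cmod \<Delta>"
    by (simp add: dist_norm norm_mult flip: mult_2 norm_power)
  have square: "N\<^sup>2 < 4 * (cmod \<Delta>)\<^sup>2" if "\<bar>N\<bar> < 2 * cmod \<Delta>"
    using power_strict_mono[OF that, of 2] by (simp add: power_mult_distrib)
  have scale: "N / 2 * m + r = d / 8 \<longleftrightarrow> 4 * (N * m + 2 * r) = d"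
    "d / 8 \<le> N / 2 * m + r \<longleftrightarrow> d \<le> 4 * (N * m + 2 * r)" for m r d :: real
    by (auto simp: field_simps)
  \<comment> \<open>Focal distance and axis length determine the squares of s and t as (2 |\<Delta>|
    - N)/4 and (2 |\<Delta>| + N)/4. Their positivity is the trace condition, whatever the range
    is.\<close>
  have axes: "\<bar>N\<bar> < 2 * cmod \<Delta>" "centered_hyperbola (csqrt \<Delta>) s t"
      "t\<^sup>2 - s\<^sup>2 = N / 2" "2 * s\<^sup>2 * t\<^sup>2 = (4 * (cmod \<Delta>)\<^sup>2 - N\<^sup>2) / 8"
    if s: "s > 0" and t: "t > 0" and foc: "dist (csqrt \<Delta>) (- csqrt \<Delta>) / 2 = sqrt (s\<^sup>2 + t\<^sup>2)"
      and lt: "l = 2 * t" for s t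
  proof -
    have st: "s\<^sup>2 + t\<^sup>2 = cmod \<Delta>"
      using focal unfolding foc by simp
    \<comment> \<open>The real square root is odd, hence negative at negative arguments; l = 2 t > 0
      makes the radicand positive, so squaring is legitimate.\<close>
    have "0 < 2 * cmod \<Delta> + N"
      using lt t unfolding l' by (metis mult_pos_pos real_sqrt_gt_0_iff zero_less_numeral)
    then have t2: "4 * t\<^sup>2 = 2 * cmod \<Delta> + N"
      using arg_cong[OF lt, of "\<lambda>x. x\<^sup>2"] by (simp add: l' power_mult_distrib)
    then have s2: "4 * s\<^sup>2 = 2 * cmod \<Delta> - N" using st by linarith
    have "0 < s\<^sup>2" "0 < t\<^sup>2" using s t by simp_all
    then show "\<bar>N\<bar> < 2 * cmod \<Delta>" using s2 t2 by linarith
    show "centered_hyperbola (csqrt \<Delta>) s t"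
      using s t st by unfold_locales auto
    show "t\<^sup>2 - s\<^sup>2 = N / 2" using s2 t2 by linarith
    have "2 * s\<^sup>2 * t\<^sup>2 = (4 * s\<^sup>2) * (4 * t\<^sup>2) / 8" by simp
    then show "2 * s\<^sup>2 * t\<^sup>2 = (4 * (cmod \<Delta>)\<^sup>2 - N\<^sup>2) / 8"
      unfolding s2 t2 by (simp add: algebra_simps power2_eq_square)
  qed
  have curve: "krein_curve J A = H \<union> {complex_of_real a}"
    if disc: "nondegenerate_hyperbolic_disc (krein_range J A) H (csqrt \<Delta>) (- csqrt \<Delta>) l" for H
  proof -
    obtain s t where st: "s > 0" "t > 0" "dist (csqrt \<Delta>) (- csqrt \<Delta>) / 2 = sqrt (s\<^sup>2 + t\<^sup>2)" "l = 2 * t"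
      and H: "H = hyperbola (csqrt \<Delta>) (- csqrt \<Delta>) s"
      using disc unfolding nondegenerate_hyperbolic_disc_def by blast
    note ax = axes[OF st]
    interpret centered_hyperbola "csqrt \<Delta>" s t by (rule ax(2))
    have "N\<^sup>2 \<noteq> 4 * (cmod \<Delta>)\<^sup>2" using square[OF ax(1)] by simp
    then have *: "z \<in> krein_curve J A \<longleftrightarrow> z = of_real a \<or>
        4 * (N * (cmod z)\<^sup>2 + 2 * Re (cnj \<Delta> * z\<^sup>2)) = 4 * (cmod \<Delta>)\<^sup>2 - N\<^sup>2" for z
      unfolding J A \<Delta> N_def by (rule krein_curve_tridiag3_iff)
    have "z \<in> H \<longleftrightarrow> 4 * (N * (cmod z)\<^sup>2 + 2 * Re (cnj \<Delta> * z\<^sup>2)) = 4 * (cmod \<Delta>)\<^sup>2 - N\<^sup>2" for z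
      unfolding H mem_hyperbola_iff ax(3,4) power2_csqrt by (rule scale)
    with * show ?thesis by auto
  qed
  have disc: "\<exists>H. nondegenerate_hyperbolic_disc (krein_range J A) H (csqrt \<Delta>) (- csqrt \<Delta>) l"
    if N: "\<bar>N\<bar> < 2 * cmod \<Delta>"
  proof -
    \<comment> \<open>t is prescribed by l, and s is what the focal distance leaves.\<close>
    define s t where "s = sqrt ((2 * cmod \<Delta> - N) / 4)" and "t = l / 2"
    have st: "s > 0" "t > 0" "dist (csqrt \<Delta>) (- csqrt \<Delta>) / 2 = sqrt (s\<^sup>2 + t\<^sup>2)" "l = 2 * t"
    proof -
      show "s > 0" "t > 0" "l = 2 * t" using N by (simp_all add: s_def t_def l')
      have "s\<^sup>2 = (2 * cmod \<Delta> - N) / 4" "t\<^sup>2 = (2 * cmod \<Delta> + N) / 4"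
        using N by (simp_all add: s_def t_def l' power_divide)
      then have "s\<^sup>2 + t\<^sup>2 = cmod \<Delta>" by argo
      then show "dist (csqrt \<Delta>) (- csqrt \<Delta>) / 2 = sqrt (s\<^sup>2 + t\<^sup>2)"
        using focal by (metis real_sqrt_unique zero_le_dist divide_nonneg_pos zero_less_numeral)
    qed
    note ax = axes[OF st]
    interpret centered_hyperbola "csqrt \<Delta>" s t by (rule ax(2))
    have *: "z \<in> krein_range J A \<longleftrightarrow>
        4 * (cmod \<Delta>)\<^sup>2 - N\<^sup>2 \<le> 4 * (N * (cmod z)\<^sup>2 + 2 * Re (cnj \<Delta> * z\<^sup>2))" for z
      using square[OF N] unfolding J A \<Delta> N_def by (rule krein_range_tridiag3_iff)
    have "z \<in> hyperbolic_disc (csqrt \<Delta>) (- csqrt \<Delta>) s \<longleftrightarrow>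
        4 * (cmod \<Delta>)\<^sup>2 - N\<^sup>2 \<le> 4 * (N * (cmod z)\<^sup>2 + 2 * Re (cnj \<Delta> * z\<^sup>2))" for z
      unfolding mem_hyperbolic_disc_iff ax(3,4) power2_csqrt by (rule scale)
    with * have "krein_range J A = hyperbolic_disc (csqrt \<Delta>) (- csqrt \<Delta>) s"
      by auto
    then show ?thesis
      unfolding nondegenerate_hyperbolic_disc_def using st by blast
  qed
  have "\<bar>N\<bar> < 2 * cmod \<Delta>"
    if "nondegenerate_hyperbolic_disc (krein_range J A) H (csqrt \<Delta>) (- csqrt \<Delta>) l" for H
    using that axes(1) unfolding nondegenerate_hyperbolic_disc_def by blast
  with curve disc show ?thesis
    unfolding ineq by blast
qed

end
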